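(* For all matroids $M$ on $S$ and $N$ on $T$, with $S\cap T=\emptyset$, the collection $$\mathcal I=\{A\subseteq S+T : A\cap S \text{ is independent in } M \text{ and } \lambda_M(A\cap S)\geq \nu_N(A\cap T)\}$$ is the family of independent subsets of a matroid on $S+T$ (denoted $M\mathbin{\Box} N$).
   Context: Matroids are on finite ground sets. $S+T$ denotes the disjoint union of $S$ and $T$. For a matroid $M$ on $S$ with rank function $\rho_M$ and rank $\rho(M)=\rho_M(S)$, the rank-lack function is $\lambda_M(A)=\rho(M)-\rho_M(A)$ for $A\subseteq S$. For a matroid $N$ on $T$ with rank function $\rho_N$, the nullity function is $\nu_N(B)=|B|-\rho_N(B)$ for $B\subseteq T$. *)

theory Defs
  imports Main
begin

locale matroid =
  fixes S :: "'a set" and \<I> :: "'a set set"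
  assumes finite_ground: "finite S"
    and indep_subset_ground: "X \<in> \<I> \<Longrightarrow> X \<subseteq> S"
    and empty_indep: "{} \<in> \<I>"
    and indep_subset: "\<lbrakk>X \<in> \<I>; Y \<subseteq> X\<rbrakk> \<Longrightarrow> Y \<in> \<I>"
    and augment: "\<lbrakk>X \<in> \<I>; Y \<in> \<I>; card X < card Y\<rbrakk> \<Longrightarrow> \<exists>y \<in> Y - X. insert y X \<in> \<I>"

(* Meaningful for finite A and a family containing the empty set, so that the
   maximum is taken over a finite nonempty set. *)
definition rank :: "'a set set \<Rightarrow> 'a set \<Rightarrow> nat" where
  "rank \<I> A = Max (card ` {X \<in> \<I>. X \<subseteq> A})"

(* Integer-valued, so that the subtraction is not truncated; likewise below. *)
definition rank_lack :: "'a set \<Rightarrow> 'a set set \<Rightarrow> 'a set \<Rightarrow> int" where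
  "rank_lack S \<I> A = int (rank \<I> S) - int (rank \<I> A)"

definition nullity :: "'a set set \<Rightarrow> 'a set \<Rightarrow> int" where
  "nullity \<I> B = int (card B) - int (rank \<I> B)"

end

(* A set A with A \<inter> S independent in M belongs to the family iff
   |A| \<le> rank M + rank_N (A \<inter> T). To augment X from a larger Y: if the inequality is
   strict for X, any new element of T may be added, and if Y has none, then Y \<inter> S is larger
   than X \<inter> S and augmentation in M applies. If it is an equality for X, then Y \<inter> T has
   larger rank in N than X \<inter> T, so an element of Y \<inter> T raises the rank of X \<inter> T. *)

theory Submission
  imports Defs
begin

context matroid
begin

lemma finite_indep: "X \<in> \<I> \<Longrightarrow> finite X"
  using finite_ground indep_subset_ground finite_subset by blast

text \<open>Makes the \<open>Max\<close> in \<open>rank\<close> well behaved for every set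
  \<open>A\<close>, even one that is infinite or not contained in \<open>S\<close>.\<close>

lemma finite_indep_cards: "finite (card ` {X \<in> \<I>. X \<subseteq> A})"
proof -
  have "{X \<in> \<I>. X \<subseteq> A} \<subseteq> Pow S"
    using indep_subset_ground by blast
  then show ?thesis
    using finite_ground by (meson finite_Pow_iff finite_imageI finite_subset)
qed

lemma card_le_rank: "X \<in> \<I> \<Longrightarrow> X \<subseteq> A \<Longrightarrow> card X \<le> rank \<I> A"
  unfolding rank_def by (rule Max_ge[OF finite_indep_cards]) blast

lemma obtain_basis:
  obtains X where "X \<in> \<I>" "X \<subseteq> A" "card X = rank \<I> A"
proof -
  have "rank \<I> A \<in> card ` {X \<in> \<I>. X \<subseteq> A}"
    unfolding rank_def using empty_indep by (intro Max_in finite_indep_cards) blast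
  then show thesis
    using that by auto
qed

lemma rank_mono: "A \<subseteq> B \<Longrightarrow> rank \<I> A \<le> rank \<I> B"
  by (metis obtain_basis card_le_rank subset_trans)

lemma rank_indep:
  assumes "X \<in> \<I>"
  shows "rank \<I> X = card X"
proof (rule antisym)
  obtain Z where "Z \<subseteq> X" "card Z = rank \<I> X"
    by (rule obtain_basis)
  then show "rank \<I> X \<le> card X"
    using finite_indep[OF assms] by (metis card_mono)
qed (simp add: assms card_le_rank)

text \<open>A maximum independent subset of \<open>B\<close> loses at most |B - A| elements when cut
  down to \<open>A\<close>, and what remains is independent. So the rank grows from \<open>A\<close>
  to \<open>B\<close> by no more than the cardinality does.\<close>

lemma nullity_mono:
  assumes "finite B" "A \<subseteq> B"
  shows "nullity \<I> A \<le> nullity \<I> B"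
proof -
  obtain Z where Z: "Z \<in> \<I>" "Z \<subseteq> B" "card Z = rank \<I> B"
    by (rule obtain_basis)
  have "Z \<inter> A \<in> \<I>"
    using Z(1) by (rule indep_subset) blast
  then have "card (Z \<inter> A) \<le> rank \<I> A"
    by (intro card_le_rank) auto
  moreover have "card Z = card (Z \<inter> A) + card (Z - A)"
    using Z(1) finite_indep by (simp add: card_Int_Diff)
  moreover have "card (Z - A) \<le> card (B - A)"
    using Z(2) assms(1) by (intro card_mono) auto
  moreover have "card B = card A + card (B - A)"
    using assms by (metis card_Int_Diff inf.absorb2)
  ultimately show ?thesis
    unfolding nullity_def using Z(3) by linarith
qed

text \<open>Augmentation is applied to maximum independent subsets of \<open>A\<close> and
  \<open>B\<close>. The element gained lies outside \<open>A\<close>, since otherwise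
  \<open>A\<close> would contain an independent set larger than its rank.\<close>

lemma rank_augment:
  assumes "rank \<I> A < rank \<I> B"
  obtains y where "y \<in> B - A" "rank \<I> A < rank \<I> (insert y A)"
proof -
  obtain X where X: "X \<in> \<I>" "X \<subseteq> A" "card X = rank \<I> A"
    by (rule obtain_basis)
  obtain Y where Y: "Y \<in> \<I>" "Y \<subseteq> B" "card Y = rank \<I> B"
    by (rule obtain_basis)
  obtain y where y: "y \<in> Y - X" "insert y X \<in> \<I>"
    using augment[OF X(1) Y(1)] assms X(3) Y(3) by auto
  have c: "card (insert y X) = Suc (rank \<I> A)"
    using y(1) X finite_indep by simp
  have "y \<notin> A"
  proof
    assume "y \<in> A"
    then have "card (insert y X) \<le> rank \<I> A"
      using X(2) by (intro card_le_rank[OF y(2)]) simp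
    then show False
      using c by simp
  qed
  moreover have "card (insert y X) \<le> rank \<I> (insert y A)"
    using X(2) by (intro card_le_rank[OF y(2)]) auto
  ultimately show thesis
    using that y(1) Y(2) c by auto
qed

end

theorem proposition1:
  fixes S T :: "'a set" and \<I> \<J> :: "'a set set"
  assumes "matroid S \<I>" and "matroid T \<J>" and "S \<inter> T = {}"
  shows "matroid (S \<union> T)
    {A. A \<subseteq> S \<union> T \<and> A \<inter> S \<in> \<I> \<and> rank_lack S \<I> (A \<inter> S) \<ge> nullity \<J> (A \<inter> T)}"
proof -
  interpret M: matroid S \<I> by fact
  interpret N: matroid T \<J> by fact
  define F where "F = {A. A \<subseteq> S \<union> T \<and> A \<inter> S \<in> \<I> \<and>
    rank_lack S \<I> (A \<inter> S) \<ge> nullity \<J> (A \<inter> T)}"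
  have finite_sub: "finite A" if "A \<subseteq> S \<union> T" for A
    using that M.finite_ground N.finite_ground by (meson finite_Un finite_subset)
  have card_split: "card A = card (A \<inter> S) + card (A \<inter> T)" if "A \<subseteq> S \<union> T" for A
  proof -
    have "A - S = A \<inter> T"
      using that assms(3) by blast
    then show ?thesis
      using card_Int_Diff[OF finite_sub[OF that], of S] by simp
  qed
  \<comment> \<open>Independence turns the rank of \<open>A \<inter> S\<close> into its cardinality,
    which combines with that of \<open>A \<inter> T\<close> to give \<open>card A\<close>. The
    resulting inequality is free of subtraction.\<close>
  have F_iff: "A \<in> F \<longleftrightarrow> A \<subseteq> S \<union> T \<and> A \<inter> S \<in> \<I> \<and>
      card A \<le> rank \<I> S + rank \<J> (A \<inter> T)" for A
    unfolding F_def rank_lack_def nullity_def using card_split[of A] M.rank_indep[of "A \<inter> S"]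
    by auto
  have "matroid (S \<union> T) F"
  proof
    show "finite (S \<union> T)"
      by (rule finite_sub) simp
  next
    show "X \<subseteq> S \<union> T" if "X \<in> F" for X
      using that F_iff by blast
  next
    show "{} \<in> F"
      using F_iff M.empty_indep by simp
  next
    \<comment> \<open>Here the original form is the convenient one: on passing to a subset, the rank
      lack can only grow and the nullity can only shrink.\<close>
    fix X Y
    assume X: "X \<in> F" and YX: "Y \<subseteq> X"
    have "Y \<inter> S \<in> \<I>"
      using X YX by (auto simp: F_def intro: M.indep_subset)
    moreover have "rank \<I> (Y \<inter> S) \<le> rank \<I> (X \<inter> S)"
      using YX by (intro M.rank_mono) blast
    moreover have "nullity \<J> (Y \<inter> T) \<le> nullity \<J> (X \<inter> T)"
      using YX N.finite_ground by (intro N.nullity_mono) auto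
    ultimately show "Y \<in> F"
      using X YX by (auto simp: F_def rank_lack_def)
  next
    fix X Y
    assume X: "X \<in> F" and Y: "Y \<in> F" and less: "card X < card Y"
    have XS: "X \<subseteq> S \<union> T" and YS: "Y \<subseteq> S \<union> T"
      using X Y F_iff by auto
    show "\<exists>y \<in> Y - X. insert y X \<in> F"
    proof (cases "card X < rank \<I> S + rank \<J> (X \<inter> T)")
      case strict: True
      \<comment> \<open>Strictness leaves room for one more element, and the bound does not drop
        when \<open>X\<close> grows, so only independence of the part in \<open>S\<close> has to be
        checked.\<close>
      have extend: "insert y X \<in> F" if "y \<in> Y - X" "insert y X \<inter> S \<in> \<I>" for y
      proof -
        have "rank \<J> (X \<inter> T) \<le> rank \<J> (insert y X \<inter> T)"
          by (rule N.rank_mono) blast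
        then show ?thesis
          using that XS YS strict finite_sub[OF XS] by (auto simp: F_iff)
      qed
      show ?thesis
      proof (cases "Y \<inter> T \<subseteq> X \<inter> T")
        case True
        \<comment> \<open>\<open>Y\<close> has no surplus over \<open>X\<close> inside
          \<open>T\<close>, so its larger size must come from \<open>S\<close>.\<close>
        then have "card (Y \<inter> T) \<le> card (X \<inter> T)"
          using finite_sub[OF XS] by (intro card_mono) auto
        then have "card (X \<inter> S) < card (Y \<inter> S)"
          using card_split[OF XS] card_split[OF YS] less by linarith
        then obtain y where y: "y \<in> Y \<inter> S - X \<inter> S" "insert y (X \<inter> S) \<in> \<I>"
          using M.augment X Y F_iff by blast
        then have "insert y X \<inter> S = insert y (X \<inter> S)"
          by blast
        then have "insert y X \<in> F"
          using y by (intro extend) auto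
        then show ?thesis
          using y(1) by blast
      next
        case False
        then obtain y where y: "y \<in> Y - X" "y \<in> T"
          by blast
        then have "insert y X \<inter> S = X \<inter> S"
          using assms(3) by blast
        then show ?thesis
          using extend y(1) X F_iff by metis
      qed
    next
      case False
      then have tight: "card X = rank \<I> S + rank \<J> (X \<inter> T)"
        using X F_iff by force
      \<comment> \<open>The bound for \<open>Y\<close> exceeds \<open>card X\<close>, which equals
        the bound for \<open>X\<close>; the common term \<open>rank \<I> S\<close> cancels.\<close>
      have "rank \<J> (X \<inter> T) < rank \<J> (Y \<inter> T)"
        using tight less Y F_iff[of Y] by linarith
      then obtain y where y: "y \<in> Y \<inter> T - X \<inter> T"
        "rank \<J> (X \<inter> T) < rank \<J> (insert y (X \<inter> T))"
        by (rule N.rank_augment)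
      have "insert y X \<inter> S = X \<inter> S" "insert y X \<inter> T = insert y (X \<inter> T)"
        using y(1) assms(3) by blast+
      \<comment> \<open>The cardinality rises by exactly one and the bound by at least one, so the
        inequality survives.\<close>
      then have "insert y X \<in> F"
        using X XS y tight finite_sub[OF XS] by (auto simp: F_iff)
      then show ?thesis
        using y(1) by blast
    qed
  qed
  then show ?thesis
    unfolding F_def .
qed

end
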